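(* Let $a,b>0$ be real numbers with $ab\neq 1$, let $k\in\mathbb{Z}$ and let $x$ be real. Then $$B^{(k)}_0(x;a,b)=1,$$ $$B^{(k)}_1(x;a,b)=\frac12\Bigl[B^{(k-1)}_1(x;a,b)+(x-\ln b)\,B^{(k)}_0(x;a,b)\Bigr],$$ and for every integer $n\ge 2$, $$\begin{aligned}B^{(k)}_n(x;a,b)=\frac{1}{n+1}\Bigl\{&B^{(k-1)}_n(x;a,b)+(x-\ln b)(\ln a+\ln b)^{n-1}B^{(k)}_0(x;a,b)\\&+(x-\ln b)\sum_{m=1}^{n-1}(\ln a+\ln b)^{n-m-1}\binom{n}{m}B^{(k)}_m(x;a,b)\\&-\sum_{m=1}^{n-1}(\ln a+\ln b)^{n-m}\binom{n}{m-1}B^{(k)}_m(x;a,b)\Bigr\}.\end{aligned}$$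
   Context: For $k\in\mathbb{Z}$, ${\rm Li}_k(z)=\sum_{m=1}^{\infty} z^m/m^k$ (for $|z|<1$, or as a formal power series). For $a,b>0$ with $ab\ne 1$ and real $x$, the generalized poly-Bernoulli polynomials with parameters $a,b$, denoted $B^{(k)}_n(x;a,b)$, are defined by the power series expansion around $t=0$ $$\frac{{\rm Li}_k(1-(ab)^{-t})}{b^t-a^{-t}}\,e^{xt}=\sum_{n=0}^{\infty}B^{(k)}_n(x;a,b)\frac{t^n}{n!}.$$ The singularity at $t=0$ on the left is removable. *)

theory Defs
  imports "HOL-Complex_Analysis.Complex_Analysis"
begin

definition polylog :: "int \<Rightarrow> real \<Rightarrow> real" where
  "polylog k z = (\<Sum>m. z ^ Suc m / real (Suc m) powi k)"

definition poly_bernoulli_gf :: "int \<Rightarrow> real \<Rightarrow> real \<Rightarrow> real \<Rightarrow> real \<Rightarrow> real" where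
  "poly_bernoulli_gf k x a b t =
     polylog k (1 - (a * b) powr (-t)) / (b powr t - a powr (-t)) * exp (x * t)"

(* The removable singularity is handled by the punctured neighbourhood "at 0": division by zero
   gives the generating function the meaningless value 0 at t = 0. *)
definition poly_bernoulli :: "int \<Rightarrow> nat \<Rightarrow> real \<Rightarrow> real \<Rightarrow> real \<Rightarrow> real" where
  "poly_bernoulli k n x a b =
     (THE c. \<forall>\<^sub>F t in at 0. (\<lambda>n. c n * (t ^ n / fact n)) sums poly_bernoulli_gf k x a b t) n"

(* Existence and uniqueness of the expansion, so that the definite description is proper. *)

lemma power_series_unique:
  fixes c d :: "nat \<Rightarrow> real"
  assumes "\<forall>\<^sub>F t in at 0. (\<lambda>n. c n * (t ^ n / fact n)) sums f t"
    and "\<forall>\<^sub>F t in at 0. (\<lambda>n. d n * (t ^ n / fact n)) sums f t"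
  shows "c = d"
proof (rule ccontr)
  assume "c \<noteq> d"
  define e where "e n = (c n - d n) / fact n" for n
  have "\<exists>n. e n \<noteq> 0"
    using \<open>c \<noteq> d\<close> by (auto simp: e_def)
  define N where "N = (LEAST n. e n \<noteq> 0)"
  have eN: "e N \<noteq> 0" and e0: "\<And>n. n < N \<Longrightarrow> e n = 0"
    unfolding N_def using \<open>\<exists>n. e n \<noteq> 0\<close> using LeastI_ex[of "\<lambda>n. e n \<noteq> 0"] by (auto dest: not_less_Least)
  have "\<forall>\<^sub>F t in at 0. (\<lambda>n. e n * t ^ n) sums 0"
    using assms
  proof eventually_elim
    case (elim t)
    from sums_diff[OF elim] show ?case
      by (simp add: e_def diff_divide_distrib algebra_simps)
  qed
  then obtain r where r: "r > 0" "\<And>t. t \<noteq> 0 \<Longrightarrow> norm t < r \<Longrightarrow> (\<lambda>n. e n * t ^ n) sums 0"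
    unfolding eventually_at by (auto simp: dist_norm)
  have s: "(\<lambda>n. e (n + N) * t ^ n) sums 0" if "t \<noteq> 0" "norm t < r" for t
  proof -
    have "(\<lambda>n. e (n + N) * t ^ (n + N)) sums 0"
      using r(2)[OF that] e0 by (subst sums_iff_shift) auto
    from sums_divide[OF this, of "t ^ N"] show ?thesis
      using that by (simp add: power_add)
  qed
  have "((\<lambda>t. 0) \<longlongrightarrow> e (0 + N)) (at (0 :: real))"
    by (rule powser_limit_0_strong[of r "\<lambda>n. e (n + N)"]) (use r(1) s in auto)
  then show False
    using eN LIM_unique[OF tendsto_const] by fastforce
qed

lemma ex1_poly_bernoulli_coeffs:
  assumes "a > 0" "b > 0" "a * b \<noteq> 1"
  shows "\<exists>!c. \<forall>\<^sub>F t in at 0.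
           (\<lambda>n. c n * (t ^ n / fact n)) sums poly_bernoulli_gf k x a b t"
proof -
  define L where "L = ln (a * b)"
  have "L \<noteq> 0"
    using assms by (simp add: L_def)
  moreover have "L = ln a + ln b"
    using assms by (simp add: L_def ln_mult)
  ultimately have L: "L \<noteq> 0" "ln b + ln a \<noteq> 0"
    by auto
  define P :: "complex fps" where "P = Abs_fps (\<lambda>m. if m = 0 then 0 else 1 / of_nat m powi k)"
  have "conv_radius (fps_nth P) = 1"
  proof (rule conv_radius_ratio_limit)
    show "\<forall>\<^sub>F n in sequentially. fps_nth P n \<noteq> 0"
      using eventually_gt_at_top[of 0] by eventually_elim (auto simp: P_def)
    have "(\<lambda>n. (real (Suc n) / real n) powi k) \<longlonglongrightarrow> 1 powi k"
      by (intro tendsto_power_int LIMSEQ_Suc_n_over_n) auto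
    moreover have "\<forall>\<^sub>F n in sequentially. (real (Suc n) / real n) powi k =
                     norm (fps_nth P n) / norm (fps_nth P (Suc n))"
      using eventually_gt_at_top[of 0]
      by eventually_elim
        (simp add: P_def norm_divide norm_power_int power_int_divide_distrib
          del: of_nat_Suc)
    ultimately show "(\<lambda>n. norm (fps_nth P n) / norm (fps_nth P (Suc n))) \<longlonglongrightarrow> 1"
      using Lim_transform_eventually by fastforce
  qed (simp add: one_ereal_def)
  then have P: "eval_fps P has_fps_expansion P"
    by (intro eval_fps_has_fps_expansion) (simp add: fps_conv_radius_def)

  define H F G where "H = 1 - fps_exp (- of_real L :: complex)" and "F = P oo H"
    and "G = fps_exp (of_real (ln b) :: complex) - fps_exp (- of_real (ln a))"
  define h g where "h t = 1 - exp (- of_real L * t)"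
    and "g t = exp (of_real (ln b) * t) - exp (- of_real (ln a) * t)" for t :: complex
  have H: "h has_fps_expansion H" "fps_nth H 0 = 0"
    unfolding h_def H_def by (intro fps_expansion_intros) simp
  have F: "(eval_fps P \<circ> h) has_fps_expansion F"
    unfolding F_def by (intro has_fps_expansion_compose P H)
  have G: "g has_fps_expansion G"
    unfolding g_def G_def by (intro fps_expansion_intros)
  have "fps_nth F 0 = 0" "fps_nth F 1 \<noteq> 0"
    using L by (auto simp: F_def fps_compose_nth P_def H_def)
  moreover have G1: "fps_nth G 0 = 0" "fps_nth G 1 \<noteq> 0"
    using L by (auto simp: G_def simp flip: of_real_add)
  ultimately have sub: "subdegree F = 1" "subdegree G = 1"
    by (auto intro!: subdegreeI)
  define Q where "Q = F / G * fps_exp (of_real x)"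
  have "(\<lambda>t. (if t = 0 then fps_nth F (subdegree G) / fps_nth G (subdegree G)
           else (eval_fps P \<circ> h) t / g t) * exp (of_real x * t)) has_fps_expansion Q"
    unfolding Q_def
    by (intro has_fps_expansion_mult has_fps_expansion_divide F G has_fps_expansion_exp)
      (use sub G1 in auto)
  then have Q: "fps_conv_radius Q > 0"
    "\<forall>\<^sub>F t in nhds 0. eval_fps Q t =
       (if t = 0 then fps_nth F (subdegree G) / fps_nth G (subdegree G)
           else (eval_fps P \<circ> h) t / g t) * exp (of_real x * t)"
    by (auto simp: has_fps_expansion_def)
  have Qs: "\<forall>\<^sub>F t in nhds 0. (\<lambda>n. fps_nth Q n * t ^ n) sums eval_fps Q t"
    using eventually_nhds_in_open[of "eball 0 (fps_conv_radius Q)" 0] Q(1)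
    by (auto elim!: eventually_mono intro!: sums_eval_fps simp: zero_ereal_def)
  have lim: "(of_real \<longlongrightarrow> (0 :: complex)) (at (0 :: real))"
    by (auto intro!: tendsto_eq_intros)
  have "((\<lambda>t. 1 - exp (- L * t)) \<longlongrightarrow> 1 - exp (- L * 0)) (at 0)"
    by (intro tendsto_intros)
  then have small: "\<forall>\<^sub>F t in at 0. norm (1 - exp (- L * t)) < 1"
    by (intro order_tendstoD(2)[OF tendsto_norm]) auto

  have pl: "eval_fps P (of_real z) = of_real (polylog k z)" if "norm z < 1" for z
  proof -
    have "(\<lambda>m. fps_nth P m * of_real z ^ m) sums eval_fps P (of_real z)"
      by (intro sums_eval_fps)
        (use that \<open>conv_radius (fps_nth P) = 1\<close> in \<open>simp add: fps_conv_radius_def one_ereal_def\<close>)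
    then have "(\<lambda>m. fps_nth P (Suc m) * of_real z ^ Suc m) sums eval_fps P (of_real z)"
      by (subst sums_Suc_iff) (simp add: P_def)
    moreover have "fps_nth P (Suc m) * of_real z ^ Suc m =
                     of_real (z ^ Suc m / real (Suc m) powi k)" for m
      by (simp add: P_def of_real_power_int del: of_nat_Suc power_Suc)
    ultimately have *: "(\<lambda>m. complex_of_real (z ^ Suc m / real (Suc m) powi k)) sums
                          eval_fps P (of_real z)"
      by (simp only:)
    note sums_Re[OF *, unfolded Re_complex_of_real] sums_Im[OF *, unfolded Im_complex_of_real]
    then show ?thesis
      by (simp add: complex_eq_iff polylog_def sums_iff)
  qed

  define c where "c n = fact n * Re (fps_nth Q n)" for n
  have "\<forall>\<^sub>F t in at 0. (\<lambda>n. c n * (t ^ n / fact n)) sums poly_bernoulli_gf k x a b t"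
    using small
      eventually_compose_filterlim[OF Q(2) lim] eventually_compose_filterlim[OF Qs lim]
      eventually_neq_at_within[of 0]
  proof eventually_elim
    case (elim t)
    have "h (of_real t) = of_real (1 - exp (- L * t))"
      by (simp add: h_def exp_of_real flip: of_real_mult of_real_minus)
    moreover have "g (of_real t) = of_real (b powr t - a powr (-t))"
      using assms by (simp add: g_def powr_def mult.commute flip: of_real_mult of_real_minus exp_of_real)
    moreover have "(a * b) powr (-t) = exp (- L * t)"
      using assms by (simp add: powr_def L_def mult.commute)
    ultimately have "eval_fps Q (of_real t) = of_real (poly_bernoulli_gf k x a b t)"
      using elim pl[of "1 - exp (- L * t)"]
      by (simp add: poly_bernoulli_gf_def flip: exp_of_real)
    with elim have "(\<lambda>n. Re (fps_nth Q n * of_real t ^ n)) sums poly_bernoulli_gf k x a b t"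
      by (metis sums_Re Re_complex_of_real)
    moreover have "Re (fps_nth Q n * of_real t ^ n) = c n * (t ^ n / fact n)" for n
      by (simp add: c_def flip: of_real_power)
    ultimately show ?case
      by simp
  qed
  then show ?thesis
    using power_series_unique by blast
qed

end

theory Submission
  imports Defs
begin

text \<open>
  Write \<open>L = ln a + ln b\<close> and \<open>y = x - ln b\<close>, and let \<open>f\<^sub>k\<close> be the analytic continuation of the
  generating function to \<open>t = 0\<close>. Then
  \<open>f\<^sub>k(t) exp(-y t) (1 - exp(-L t)) = Li\<^sub>k(1 - exp(-L t))\<close> near \<open>0\<close>. Differentiating with
  \<open>z Li\<^sub>k'(z) = Li\<^sub>k\<^sub>-\<^sub>1(z)\<close> yields
  \<open>L f\<^sub>k\<^sub>-\<^sub>1 = L f\<^sub>k + (exp(L t) - 1) (f\<^sub>k' - y f\<^sub>k)\<close>, and the recurrence is the comparison of the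
  coefficients of \<open>t\<^sup>n / n!\<close>; the derivative at \<open>t = 0\<close> gives the value at \<open>n = 0\<close>.
\<close>

section \<open>Uniqueness of real power series expansions\<close>

text \<open>Scaling the coefficients by \<open>fact n\<close> reduces this to
  \<open>power_series_unique\<close>. Agreement is asked for on the punctured neighbourhood only,
  because the generating function has no meaningful value at \<open>0\<close>.\<close>

lemma has_fps_expansion_real_unique:
  fixes F G :: "real fps"
  assumes "f has_fps_expansion F" "g has_fps_expansion G" "\<forall>\<^sub>F t in at 0. f t = g t"
  shows "F = G"
proof -
  have sums: "\<forall>\<^sub>F t in at 0. (\<lambda>n. (fact n * fps_nth F n) * (t ^ n / fact n)) sums f t"
    if "f has_fps_expansion F" for f :: "real \<Rightarrow> real" and F
  proof -
    have "\<forall>\<^sub>F t in nhds 0. t \<in> eball 0 (fps_conv_radius F)"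
      using that by (intro eventually_nhds_in_open)
        (auto simp: has_fps_expansion_def zero_ereal_def)
    moreover have "\<forall>\<^sub>F t in nhds 0. eval_fps F t = f t"
      using that by (simp add: has_fps_expansion_def)
    ultimately have "\<forall>\<^sub>F t in nhds 0. (\<lambda>n. fps_nth F n * t ^ n) sums f t"
      by eventually_elim (metis in_eball_iff dist_0_norm sums_eval_fps)
    then show ?thesis
      by (auto simp: eventually_at_filter elim: eventually_mono)
  qed
  have "\<forall>\<^sub>F t in at 0. (\<lambda>n. (fact n * fps_nth G n) * (t ^ n / fact n)) sums f t"
    using sums[OF assms(2)] assms(3) by eventually_elim simp
  from power_series_unique[OF sums[OF assms(1)] this] show ?thesis
    by (intro fps_ext) (simp add: fun_eq_iff)
qed

section \<open>The polylogarithm as a power series\<close>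

text \<open>The case \<open>m = 0\<close> is explicit because for \<open>k = 0\<close> the quotient
  \<open>1 / 0 powi 0\<close> would be \<open>1\<close>, whereas the polylogarithm has no constant
  term.\<close>

definition polylog_fps :: "int \<Rightarrow> real fps" where
  "polylog_fps k = Abs_fps (\<lambda>m. if m = 0 then 0 else 1 / real m powi k)"

lemma fps_X_mult_deriv_polylog_fps: "fps_X * fps_deriv (polylog_fps k) = polylog_fps (k - 1)"
  by (intro fps_ext) (auto simp: polylog_fps_def power_int_diff)

text \<open>Ratio test: consecutive coefficients have quotient \<open>((n + 1) / n) powi k\<close>,
  which tends to \<open>1\<close> for either sign of \<open>k\<close>.\<close>

lemma fps_conv_radius_polylog_fps: "fps_conv_radius (polylog_fps k) = 1"
  unfolding fps_conv_radius_def
proof (rule conv_radius_ratio_limit)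
  show "\<forall>\<^sub>F n in sequentially. fps_nth (polylog_fps k) n \<noteq> 0"
    using eventually_gt_at_top[of 0] by eventually_elim (auto simp: polylog_fps_def)
  have "(\<lambda>n. (real (Suc n) / real n) powi k) \<longlonglongrightarrow> 1 powi k"
    by (intro tendsto_power_int LIMSEQ_Suc_n_over_n) auto
  moreover have "\<forall>\<^sub>F n in sequentially. (real (Suc n) / real n) powi k =
                   norm (fps_nth (polylog_fps k) n) / norm (fps_nth (polylog_fps k) (Suc n))"
    using eventually_gt_at_top[of 0]
    by eventually_elim
      (simp add: polylog_fps_def power_int_divide_distrib power_int_abs del: of_nat_Suc)
  ultimately show "(\<lambda>n. norm (fps_nth (polylog_fps k) n) /
                        norm (fps_nth (polylog_fps k) (Suc n))) \<longlonglongrightarrow> 1"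
    using Lim_transform_eventually by fastforce
qed (simp add: one_ereal_def)

lemma eval_polylog_fps:
  assumes "\<bar>z\<bar> < 1"
  shows "eval_fps (polylog_fps k) z = polylog k z"
proof -
  have "(\<lambda>m. fps_nth (polylog_fps k) m * z ^ m) sums eval_fps (polylog_fps k) z"
    by (intro sums_eval_fps) (use assms in \<open>simp add: fps_conv_radius_polylog_fps one_ereal_def\<close>)
  then have "(\<lambda>m. fps_nth (polylog_fps k) (Suc m) * z ^ Suc m) sums eval_fps (polylog_fps k) z"
    by (subst sums_Suc_iff) (simp add: polylog_fps_def)
  then show ?thesis
    by (simp add: polylog_def polylog_fps_def sums_iff del: of_nat_Suc power_Suc)
qed

lemma eval_deriv_polylog_fps:
  assumes "\<bar>z\<bar> < 1"
  shows "z * eval_fps (fps_deriv (polylog_fps k)) z = polylog (k - 1) z"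
proof -
  have "norm z < fps_conv_radius (fps_deriv (polylog_fps k))"
    using assms fps_conv_radius_deriv[of "polylog_fps k"]
    by (intro less_le_trans[OF _ fps_conv_radius_deriv])
      (simp add: fps_conv_radius_polylog_fps one_ereal_def)
  then have "z * eval_fps (fps_deriv (polylog_fps k)) z =
               eval_fps (fps_X * fps_deriv (polylog_fps k)) z"
    by (subst eval_fps_mult) auto
  then show ?thesis
    using assms by (simp add: fps_X_mult_deriv_polylog_fps eval_polylog_fps)
qed

lemma has_real_derivative_polylog:
  assumes "\<bar>z\<bar> < 1"
  shows "(polylog k has_real_derivative eval_fps (fps_deriv (polylog_fps k)) z) (at z)"
proof -
  have "(eval_fps (polylog_fps k) has_real_derivative eval_fps (fps_deriv (polylog_fps k)) z) (at z)"
    using assms by (intro has_field_derivative_eval_fps)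
      (simp add: fps_conv_radius_polylog_fps one_ereal_def)
  then show ?thesis
    by (rule has_field_derivative_transform_within_open[of _ _ _ "{-1<..<1}"])
      (use assms in \<open>auto simp: eval_polylog_fps\<close>)
qed

section \<open>The generating function and its power series\<close>

definition poly_bernoulli_fps :: "int \<Rightarrow> real \<Rightarrow> real \<Rightarrow> real \<Rightarrow> real fps" where
  "poly_bernoulli_fps k x a b = Abs_fps (\<lambda>n. poly_bernoulli k n x a b / fact n)"

text \<open>By \<open>ex1_poly_bernoulli_coeffs\<close> the definite description is proper, so the
  series sums to the generating function at all small nonzero \<open>t\<close>; convergence at one
  such point already makes the radius positive.\<close>

lemma
  assumes "a > 0" "b > 0" "a * b \<noteq> 1"
  shows fps_conv_radius_poly_bernoulli_fps: "fps_conv_radius (poly_bernoulli_fps k x a b) > 0"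
    and eval_poly_bernoulli_fps:
      "\<forall>\<^sub>F t in at 0. eval_fps (poly_bernoulli_fps k x a b) t = poly_bernoulli_gf k x a b t"
proof -
  have "\<forall>\<^sub>F t in at 0. (\<lambda>n. poly_bernoulli k n x a b * (t ^ n / fact n)) sums
          poly_bernoulli_gf k x a b t"
    using theI'[OF ex1_poly_bernoulli_coeffs[OF assms, of k x]]
    unfolding poly_bernoulli_def by blast
  then have *: "\<forall>\<^sub>F t in at 0. (\<lambda>n. fps_nth (poly_bernoulli_fps k x a b) n * t ^ n) sums
          poly_bernoulli_gf k x a b t"
    by (simp add: poly_bernoulli_fps_def)
  from eventually_happens[OF eventually_conj[OF * eventually_neq_at_within[of 0]]]
  obtain t where "t \<noteq> 0" "summable (\<lambda>n. fps_nth (poly_bernoulli_fps k x a b) n * t ^ n)"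
    by (auto simp: sums_iff)
  then show "fps_conv_radius (poly_bernoulli_fps k x a b) > 0"
    using conv_radius_geI[of "fps_nth (poly_bernoulli_fps k x a b)" t]
    by (auto simp: fps_conv_radius_def zero_ereal_def intro: less_le_trans[rotated])
  show "\<forall>\<^sub>F t in at 0. eval_fps (poly_bernoulli_fps k x a b) t = poly_bernoulli_gf k x a b t"
    using * by eventually_elim (simp add: eval_fps_def sums_iff)
qed

text \<open>The denominator \<open>b powr t - a powr (-t)\<close> factors as
  \<open>exp (ln b * t) * (1 - exp (- L * t))\<close>. Since \<open>L = ln (a * b)\<close> and
  \<open>t\<close> are nonzero, both factors cancel.\<close>

lemma poly_bernoulli_gf_eq:
  assumes "a > 0" "b > 0" "a * b \<noteq> 1" "t \<noteq> 0"
  defines "L \<equiv> ln a + ln b"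
  shows "poly_bernoulli_gf k x a b t * exp ((ln b - x) * t) * (1 - exp (- L * t)) =
           polylog k (1 - exp (- L * t))"
proof -
  have "L = ln (a * b)"
    using assms by (simp add: L_def ln_mult)
  then have "L \<noteq> 0" and "(a * b) powr (- t) = exp (- L * t)"
    using assms by (auto simp: powr_def mult.commute)
  moreover have "b powr t - a powr (- t) = exp (ln b * t) * (1 - exp (- L * t))"
    using assms by (simp add: powr_def L_def algebra_simps flip: exp_add)
  moreover have "exp ((ln b - x) * t) = exp (ln b * t) / exp (x * t)"
    by (simp add: algebra_simps exp_diff)
  ultimately show ?thesis
    using assms(4) by (simp add: poly_bernoulli_gf_def)
qed

section \<open>The differential equation\<close>

text \<open>The two sides are the derivatives of the two sides of
  \<open>poly_bernoulli_gf_eq\<close>, with the power series in place of the generating function.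
  The neighbourhood includes \<open>0\<close>, where the identity determines the constant
  coefficient.\<close>

lemma eventually_poly_bernoulli_deriv_eq:
  fixes a b x :: real and k :: int
  assumes "a > 0" "b > 0" "a * b \<noteq> 1"
  defines "L \<equiv> ln a + ln b" and "F \<equiv> poly_bernoulli_fps k x a b"
  shows "\<forall>\<^sub>F t in nhds 0.
    exp ((ln b - x) * t) * ((1 - exp (- L * t)) *
      (eval_fps (fps_deriv F) t - (x - ln b) * eval_fps F t) + L * exp (- L * t) * eval_fps F t) =
    L * exp (- L * t) * eval_fps (fps_deriv (polylog_fps k)) (1 - exp (- L * t))"
proof -
  define \<Phi> where "\<Phi> t = eval_fps F t * exp ((ln b - x) * t) * (1 - exp (- L * t))" for t
  define \<Psi> where "\<Psi> t = polylog k (1 - exp (- L * t))" for t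
  have "\<forall>\<^sub>F t in at 0. \<Phi> t = \<Psi> t"
    using eval_poly_bernoulli_fps[OF assms(1-3), of k x] eventually_neq_at_within[of 0]
    by eventually_elim
      (use poly_bernoulli_gf_eq[OF assms(1-3)] in \<open>simp add: \<Phi>_def \<Psi>_def L_def F_def\<close>)
  \<comment> \<open>Both values are \<open>0\<close>, which fills the puncture.\<close>
  moreover have "\<Phi> 0 = \<Psi> 0"
    by (simp add: \<Phi>_def \<Psi>_def polylog_def)
  ultimately have "\<forall>\<^sub>F t in nhds 0. \<Phi> t = \<Psi> t"
    by (auto simp: eventually_at_filter elim!: eventually_mono)
  \<comment> \<open>Equal derivatives at \<open>t\<close> require equality on a whole neighbourhood
    of \<open>t\<close>.\<close>
  then have "\<forall>\<^sub>F t in nhds 0. \<forall>\<^sub>F s in nhds t. \<Phi> s = \<Psi> s"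
    by (simp add: eventually_eventually)
  moreover have "\<forall>\<^sub>F t in nhds 0. t \<in> eball 0 (fps_conv_radius F)"
    using fps_conv_radius_poly_bernoulli_fps[OF assms(1-3), of k x]
    by (intro eventually_nhds_in_open) (auto simp: F_def zero_ereal_def)
  moreover have "\<forall>\<^sub>F t in nhds 0. \<bar>1 - exp (- L * t)\<bar> < 1"
  proof -
    have "((\<lambda>t. \<bar>1 - exp (- L * t)\<bar>) \<longlongrightarrow> \<bar>1 - exp (- L * 0)\<bar>) (nhds 0)"
      by (intro tendsto_intros filterlim_ident)
    then show ?thesis
      by (rule order_tendstoD) simp
  qed
  ultimately show ?thesis
  proof eventually_elim
    case (elim t)
    have "(\<Phi> has_real_derivative exp ((ln b - x) * t) * ((1 - exp (- L * t)) *
        (eval_fps (fps_deriv F) t - (x - ln b) * eval_fps F t)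
        + L * exp (- L * t) * eval_fps F t)) (at t)"
      unfolding \<Phi>_def
      by (rule derivative_eq_intros has_field_derivative_eval_fps refl | use elim in simp; fail)+
        (simp add: algebra_simps)
    moreover have "(\<Psi> has_real_derivative
        L * exp (- L * t) * eval_fps (fps_deriv (polylog_fps k)) (1 - exp (- L * t))) (at t)"
    proof -
      have "((\<lambda>t. 1 - exp (- L * t)) has_real_derivative L * exp (- L * t)) (at t)"
        by (auto intro!: derivative_eq_intros)
      from DERIV_chain2[OF has_real_derivative_polylog[OF elim(3)] this] show ?thesis
        unfolding \<Psi>_def by (simp add: mult.commute)
    qed
    ultimately show ?case
      using DERIV_cong_ev[OF refl elim(1) refl] DERIV_unique by metis
  qed
qed

text \<open>At \<open>t = 0\<close> the term with factor \<open>1 - exp (- L * t)\<close> drops out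
  of the derivative identity. What remains is \<open>L\<close> times the constant coefficient on the
  left and \<open>L\<close> times the linear coefficient of the polylogarithm, which is
  \<open>1\<close>, on the right.\<close>

lemma poly_bernoulli_0:
  assumes "a > 0" "b > 0" "a * b \<noteq> 1"
  shows "poly_bernoulli k 0 x a b = 1"
proof -
  have "ln a + ln b \<noteq> 0"
    using assms by (simp flip: ln_mult_pos)
  with eventually_nhds_x_imp_x[OF eventually_poly_bernoulli_deriv_eq[OF assms, of x k]]
  show ?thesis
    by (simp add: eval_fps_at_0 poly_bernoulli_fps_def polylog_fps_def)
qed

lemma poly_bernoulli_fps_recurrence:
  fixes a b x :: real and k :: int
  assumes "a > 0" "b > 0" "a * b \<noteq> 1"
  defines "L \<equiv> ln a + ln b" and "F \<equiv> \<lambda>k. poly_bernoulli_fps k x a b"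
  shows "fps_const L * F (k - 1) = fps_const L * F k +
           (fps_exp L - 1) * (fps_deriv (F k) - fps_const (x - ln b) * F k)"
proof (rule has_fps_expansion_real_unique)
  have F: "eval_fps (F k) has_fps_expansion F k" for k
    using fps_conv_radius_poly_bernoulli_fps[OF assms(1-3)]
    by (simp add: F_def eval_fps_has_fps_expansion)
  have F': "eval_fps (fps_deriv (F k)) has_fps_expansion fps_deriv (F k)"
    using fps_conv_radius_poly_bernoulli_fps[OF assms(1-3)]
    by (intro eval_fps_has_fps_expansion less_le_trans[OF _ fps_conv_radius_deriv])
      (simp add: F_def)
  show "(\<lambda>t. L * eval_fps (F (k - 1)) t) has_fps_expansion fps_const L * F (k - 1)"
    by (intro fps_expansion_intros F)
  show "(\<lambda>t. L * eval_fps (F k) t + (exp (L * t) - 1) *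
            (eval_fps (fps_deriv (F k)) t - (x - ln b) * eval_fps (F k) t)) has_fps_expansion
        fps_const L * F k + (fps_exp L - 1) * (fps_deriv (F k) - fps_const (x - ln b) * F k)"
    by (intro fps_expansion_intros F F')
  have "L \<noteq> 0"
    using assms by (simp add: L_def flip: ln_mult_pos)
  have "((\<lambda>t. \<bar>1 - exp (- L * t)\<bar>) \<longlongrightarrow> \<bar>1 - exp (- L * 0)\<bar>) (at 0)"
    by (intro tendsto_intros)
  then have "\<forall>\<^sub>F t in at 0. \<bar>1 - exp (- L * t)\<bar> < 1"
    by (rule order_tendstoD) simp
  moreover have "\<forall>\<^sub>F t in at 0. exp ((ln b - x) * t) * ((1 - exp (- L * t)) *
      (eval_fps (fps_deriv (F k)) t - (x - ln b) * eval_fps (F k) t)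
      + L * exp (- L * t) * eval_fps (F k) t) =
    L * exp (- L * t) * eval_fps (fps_deriv (polylog_fps k)) (1 - exp (- L * t))"
    using eventually_poly_bernoulli_deriv_eq[OF assms(1-3), of x k]
    by (simp add: F_def L_def eventually_at_filter eventually_mono)
  ultimately show "\<forall>\<^sub>F t in at 0. L * eval_fps (F (k - 1)) t =
      L * eval_fps (F k) t + (exp (L * t) - 1) *
        (eval_fps (fps_deriv (F k)) t - (x - ln b) * eval_fps (F k) t)"
    using eval_poly_bernoulli_fps[OF assms(1-3), of "k - 1" x] eventually_neq_at_within[of 0]
  proof eventually_elim
    case (elim t)
    define e where "e = exp (- L * t)"
    define w where "w = exp ((ln b - x) * t)"
    define D where "D = eval_fps (fps_deriv (polylog_fps k)) (1 - e)"
    define f0 f f' where "f0 = eval_fps (F (k - 1)) t" and "f = eval_fps (F k) t"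
      and "f' = eval_fps (fps_deriv (F k)) t"
    have e: "e > 0" "e \<noteq> 1" "exp (L * t) = 1 / e" and w: "w > 0"
      using \<open>L \<noteq> 0\<close> elim(4) by (auto simp: e_def w_def exp_minus field_simps)
    \<comment> \<open>Both sides equal \<open>polylog (k - 1) (1 - e)\<close>: the left by
      \<open>poly_bernoulli_gf_eq\<close>, the right by the derivative rule for the
      polylogarithm.\<close>
    have "f0 * w * (1 - e) = (1 - e) * D"
      using poly_bernoulli_gf_eq[OF assms(1-3) elim(4), of "k - 1" x] elim(1,3)
        eval_deriv_polylog_fps[of "1 - e" k]
      by (simp add: f0_def w_def e_def D_def L_def F_def)
    then have "D = f0 * w"
      using e(2) by simp
    moreover have "w * ((1 - e) * (f' - (x - ln b) * f) + L * e * f) = L * e * D"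
      using elim(2) by (simp add: w_def e_def D_def f_def f'_def)
    ultimately have "w * ((1 - e) * (f' - (x - ln b) * f) + L * e * f) = w * (L * e * f0)"
      by (simp add: mult.assoc)
    then have "(1 - e) * (f' - (x - ln b) * f) + L * e * f = L * e * f0"
      using w by simp
    \<comment> \<open>Division by \<open>e\<close> turns \<open>1 - e\<close> into
      \<open>1 / e - 1\<close>, that is, \<open>exp (L * t) - 1\<close>.\<close>
    then have "L * f0 = L * f + (1 / e - 1) * (f' - (x - ln b) * f)"
      using e(1) by (simp add: field_simps)
    then show ?case
      by (simp add: e(3) f0_def f_def f'_def)
  qed
qed

section \<open>Comparison of coefficients\<close>

text \<open>Coefficient \<open>n\<close> of \<open>poly_bernoulli_fps_recurrence\<close>. Every
  surviving term of the Cauchy product carries a factor \<open>L\<close>, and cancelling it lowers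
  the exponent to \<open>n - m - 1\<close>.\<close>

lemma poly_bernoulli_recurrence:
  assumes "a > 0" "b > 0" "a * b \<noteq> 1"
  defines "L \<equiv> ln a + ln b"
  shows "poly_bernoulli (k - 1) n x a b = poly_bernoulli k n x a b +
    (\<Sum>m<n. L ^ (n - m - 1) * real (n choose m) *
      (poly_bernoulli k (Suc m) x a b - (x - ln b) * poly_bernoulli k m x a b))"
proof -
  define B where "B k m = poly_bernoulli k m x a b" for k m
  define D where "D m = B k (Suc m) - (x - ln b) * B k m" for m
  have "L \<noteq> 0"
    using assms by (simp add: L_def flip: ln_mult_pos)
  have D: "fps_nth (fps_deriv (poly_bernoulli_fps k x a b) -
             fps_const (x - ln b) * poly_bernoulli_fps k x a b) m = D m / fact m" for m
    by (simp add: poly_bernoulli_fps_def D_def B_def diff_divide_distrib del: of_nat_Suc)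
  have E: "fps_nth (fps_exp L - 1) m = (if m = 0 then 0 else L ^ m / fact m)" for m
    by simp
  have "L * (B (k - 1) n / fact n) = L * (B k n / fact n) +
          fps_nth ((fps_exp L - 1) * (fps_deriv (poly_bernoulli_fps k x a b) -
             fps_const (x - ln b) * poly_bernoulli_fps k x a b)) n"
    using arg_cong[OF poly_bernoulli_fps_recurrence[OF assms(1-3), of k x], of "\<lambda>f. fps_nth f n"]
    by (simp add: poly_bernoulli_fps_def B_def L_def)
  also have "fps_nth ((fps_exp L - 1) * (fps_deriv (poly_bernoulli_fps k x a b) -
             fps_const (x - ln b) * poly_bernoulli_fps k x a b)) n =
      (\<Sum>m=0..n. D m / fact m * (if n - m = 0 then 0 else L ^ (n - m) / fact (n - m)))"
    by (subst mult.commute, subst fps_mult_nth) (simp only: D E)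
  \<comment> \<open>The summand \<open>m = n\<close> vanishes because \<open>fps_exp L - 1\<close>
    has no constant term.\<close>
  also have "\<dots> = (\<Sum>m<n. D m / fact m * (L ^ (n - m) / fact (n - m)))"
    by (rule sum.mono_neutral_cong_right) auto
  also have "\<dots> = (\<Sum>m<n. L / fact n * (L ^ (n - m - 1) * real (n choose m) * D m))"
  proof (intro sum.cong refl)
    fix m assume "m \<in> {..<n}"
    then have "L ^ (n - m) = L * L ^ (n - m - 1)"
      and "real (n choose m) = fact n / (fact m * fact (n - m))"
      by (auto simp: binomial_fact Suc_diff_Suc simp flip: power_Suc)
    then show "D m / fact m * (L ^ (n - m) / fact (n - m)) =
        L / fact n * (L ^ (n - m - 1) * real (n choose m) * D m)"
      by simp
  qed
  also have "\<dots> = L / fact n * (\<Sum>m<n. L ^ (n - m - 1) * real (n choose m) * D m)"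
    by (rule sum_distrib_left [symmetric])
  finally have "L / fact n * B (k - 1) n =
      L / fact n * (B k n + (\<Sum>m<n. L ^ (n - m - 1) * real (n choose m) * D m))"
    by (simp add: algebra_simps)
  then show ?thesis
    using \<open>L \<noteq> 0\<close> by (simp add: B_def D_def)
qed

theorem theorem2p8:
  fixes a b x :: real and k :: int
  assumes "a > 0" and "b > 0" and "a * b \<noteq> 1"
  shows "poly_bernoulli k 0 x a b = 1 \<and>
    poly_bernoulli k 1 x a b =
      1 / 2 * (poly_bernoulli (k - 1) 1 x a b + (x - ln b) * poly_bernoulli k 0 x a b) \<and>
    (\<forall>n\<ge>2. poly_bernoulli k n x a b =
      1 / (real n + 1) *
        (poly_bernoulli (k - 1) n x a b
         + (x - ln b) * (ln a + ln b) ^ (n - 1) * poly_bernoulli k 0 x a b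
         + (x - ln b) * (\<Sum>m = 1..n - 1.
             (ln a + ln b) ^ (n - m - 1) * real (n choose m) * poly_bernoulli k m x a b)
         - (\<Sum>m = 1..n - 1.
             (ln a + ln b) ^ (n - m) * real (n choose (m - 1)) * poly_bernoulli k m x a b)))"
proof (intro conjI allI impI)
  show "poly_bernoulli k 0 x a b = 1"
    by (rule poly_bernoulli_0[OF assms])
  \<comment> \<open>For \<open>n = 1\<close> the sum consists of the summand \<open>m = 0\<close>,
    which supplies a second copy of the left-hand side; hence the factor
    \<open>1 / 2\<close>.\<close>
  show "poly_bernoulli k 1 x a b =
      1 / 2 * (poly_bernoulli (k - 1) 1 x a b + (x - ln b) * poly_bernoulli k 0 x a b)"
    using poly_bernoulli_recurrence[OF assms, of k 1 x] by simp
next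
  fix n :: nat
  assume "n \<ge> 2"
  then obtain N where n: "n = Suc N"
    by (cases n) auto
  define L y where "L = ln a + ln b" and "y = x - ln b"
  define B where "B m = poly_bernoulli k m x a b" for m
  define c where "c m = L ^ (n - m - 1) * real (n choose m)" for m
  \<comment> \<open>The top summand \<open>m = n - 1\<close> has \<open>c m = n\<close> and involves
    \<open>B n\<close> itself. Joined with the \<open>B n\<close> outside the sum, it produces the
    factor \<open>n + 1\<close>.\<close>
  have "(\<Sum>m<n. c m * B (Suc m)) = (\<Sum>m<N. c m * B (Suc m)) + real n * B n"
    by (simp add: n c_def)
  \<comment> \<open>The shift of \<open>m\<close> by one raises the exponent to \<open>n - m\<close>
    and lowers the binomial index to \<open>m - 1\<close>.\<close>
  also have "(\<Sum>m<N. c m * B (Suc m)) =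
      (\<Sum>m = 1..n - 1. L ^ (n - m) * real (n choose (m - 1)) * B m)"
    by (rule sum.reindex_bij_witness[of _ "\<lambda>m. m - 1" Suc]) (auto simp: n c_def)
  finally have upper: "(\<Sum>m<n. c m * B (Suc m)) =
      (\<Sum>m = 1..n - 1. L ^ (n - m) * real (n choose (m - 1)) * B m) + real n * B n" .
  \<comment> \<open>The summand \<open>m = 0\<close> is split off, since the claim lists the
    \<open>B 0\<close> term separately.\<close>
  have "{..<n} = insert 0 {1..n - 1}"
    by (auto simp: n)
  then have lower: "(\<Sum>m<n. c m * B m) = L ^ (n - 1) * B 0 + (\<Sum>m = 1..n - 1. c m * B m)"
    by (simp add: c_def)
  have "poly_bernoulli (k - 1) n x a b = B n + (\<Sum>m<n. c m * (B (Suc m) - y * B m))"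
    using poly_bernoulli_recurrence[OF assms, of k n x] by (simp add: B_def c_def L_def y_def)
  also have "(\<Sum>m<n. c m * (B (Suc m) - y * B m)) =
      (\<Sum>m<n. c m * B (Suc m)) - y * (\<Sum>m<n. c m * B m)"
    by (simp add: sum_subtractf sum_distrib_left algebra_simps)
  finally have "(real n + 1) * B n = poly_bernoulli (k - 1) n x a b + y * L ^ (n - 1) * B 0
      + y * (\<Sum>m = 1..n - 1. c m * B m)
      - (\<Sum>m = 1..n - 1. L ^ (n - m) * real (n choose (m - 1)) * B m)"
    unfolding upper lower by (simp add: algebra_simps)
  then have "B n = 1 / (real n + 1) * (poly_bernoulli (k - 1) n x a b + y * L ^ (n - 1) * B 0
      + y * (\<Sum>m = 1..n - 1. c m * B m)
      - (\<Sum>m = 1..n - 1. L ^ (n - m) * real (n choose (m - 1)) * B m))"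
    by (metis nonzero_mult_div_cancel_left of_nat_0_le_iff add_nonneg_eq_0_iff zero_le_one
        zero_neq_one mult_1 times_divide_eq_left)
  then show "poly_bernoulli k n x a b =
      1 / (real n + 1) *
        (poly_bernoulli (k - 1) n x a b
         + (x - ln b) * (ln a + ln b) ^ (n - 1) * poly_bernoulli k 0 x a b
         + (x - ln b) * (\<Sum>m = 1..n - 1.
             (ln a + ln b) ^ (n - m - 1) * real (n choose m) * poly_bernoulli k m x a b)
         - (\<Sum>m = 1..n - 1.
             (ln a + ln b) ^ (n - m) * real (n choose (m - 1)) * poly_bernoulli k m x a b))"
    by (simp only: B_def c_def L_def y_def)
qed

end
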